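(* Let $f:\mathbb{R}^n\to\mathbb{R}$ be $L$-smooth ($L>0$), let $g:\mathbb{R}^d\to\mathbb{R}^n$ be such that $\mathcal{Z}=\operatorname{cl}\{g(\theta):\theta\in\mathbb{R}^d\}$ is convex, and define the surrogate losses $$\ell_t(\theta)=\tfrac12\left\|g(\theta)-z_t+\tfrac1L\nabla f(z_t)\right\|^2,\qquad z_t=g(\theta_t),\qquad \ell_t^\ast=\inf_{\theta\in\mathbb{R}^d}\ell_t(\theta).$$ Let $\alpha\in[0,1)$ and suppose that the trajectory $\{\theta_t\}_{t\in\mathbb{N}}$ satisfies the $\alpha$-descent condition $\ell_t(\theta_{t+1})-\ell_t^\ast\le\alpha^2(\ell_t(\theta_t)-\ell_t^\ast)$ for every $t$. Then for every $t$, $$f(z_{t+1})\le f(z_t)-L(1-\alpha^2)\left(\ell_t(\theta_t)-\ell_t^\ast\right).$$ If moreover $f$ is bounded below, then $z_t-z_t^\ast\to0$ as $t\to\infty$, where $z_t^\ast=\Pi\left(z_t-\frac1L\nabla f(z_t)\right)$ and $\Pi$ is the Euclidean projection onto $\mathcal{Z}$.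
   Context: $\|\cdot\|$ is the Euclidean norm; $\operatorname{cl}$ denotes closure. $f$ is $L$-smooth if it is differentiable and $\|\nabla f(x)-\nabla f(y)\|\le L\|x-y\|$ for all $x,y\in\mathbb{R}^n$. *)

theory Defs
  imports "HOL-Analysis.Analysis"
begin

definition grad :: "(real^'n \<Rightarrow> real) \<Rightarrow> real^'n \<Rightarrow> real^'n" where
  "grad f x = (THE D. GDERIV f x :> D)"

lemma differentiable_GDERIV_grad:
  fixes f :: "real^'n \<Rightarrow> real"
  assumes "f differentiable at x"
  shows "GDERIV f x :> grad f x"
proof -
  obtain f' where f': "(f has_derivative f') (at x)"
    using assms by (auto simp: differentiable_def)
  interpret linear f'
    using f' by (rule has_derivative_linear)
  have rep: "f' h = h \<bullet> adjoint f' 1" for h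
    using adjoint_works[OF linear_axioms, of h 1] by simp
  have "(\<lambda>h. h \<bullet> adjoint f' 1) = f'"
    by (rule ext) (rule rep[symmetric])
  then have ex: "GDERIV f x :> adjoint f' 1"
    using f' by (simp add: gderiv_def)
  have uniq: "D = E" if "GDERIV f x :> D" "GDERIV f x :> E" for D E
  proof -
    have "(\<lambda>h. h \<bullet> D) = (\<lambda>h. h \<bullet> E)"
      using that unfolding gderiv_def by (rule has_derivative_unique)
    then have "\<forall>h. h \<bullet> D = h \<bullet> E"
      by (rule fun_cong[THEN allI])
    then show ?thesis
      by (simp only: vector_eq_rdot vector_eq_ldot)
  qed
  show ?thesis
    unfolding grad_def by (rule theI, rule ex, rule uniq[OF _ ex])
qed

definition smooth_with :: "real \<Rightarrow> (real^'n \<Rightarrow> real) \<Rightarrow> bool" where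
  "smooth_with L f \<longleftrightarrow>
     (\<forall>x. f differentiable at x) \<and> (\<forall>x y. norm (grad f x - grad f y) \<le> L * norm (x - y))"

(* surrogate_loss L f g z is the loss anchored at the point z; the t-th loss is the one
   anchored at g (theta_t). *)
definition surrogate_loss ::
  "real \<Rightarrow> (real^'n \<Rightarrow> real) \<Rightarrow> (real^'d \<Rightarrow> real^'n) \<Rightarrow> real^'n \<Rightarrow> real^'d \<Rightarrow> real" where
  "surrogate_loss L f g z \<theta> = 1/2 * (norm (g \<theta> - z + (1/L) *\<^sub>R grad f z))\<^sup>2"

(* The infimum is over a set bounded below by 0, hence a genuine real infimum. *)
definition surrogate_inf ::
  "real \<Rightarrow> (real^'n \<Rightarrow> real) \<Rightarrow> (real^'d \<Rightarrow> real^'n) \<Rightarrow> real^'n \<Rightarrow> real" where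
  "surrogate_inf L f g z = (INF \<theta>. surrogate_loss L f g z \<theta>)"

end

theory Submission
  imports Defs
begin

text \<open>
  With the anchor \<open>x = g \<theta>\<close> and \<open>w = x - (1/L) \<nabla>f x\<close> the surrogate loss is half the squared
  distance to \<open>w\<close>, and \<open>L\<close> times its change from \<open>x\<close> to \<open>y\<close> is exactly the quadratic correction
  in the descent lemma \<open>f y \<le> f x + (y - x) \<bullet> \<nabla>f x + L/2 \<parallel>y - x\<parallel>\<^sup>2\<close>; this gives the decrease of \<open>f\<close>.
  If \<open>f\<close> is bounded below, the decrements, hence the gaps between loss and infimum, tend to zero,
  and by the obtuse angle criterion for the projection onto a convex set the gap dominates
  \<open>1/2 \<parallel>z - z*\<parallel>\<^sup>2\<close>.
\<close>

text \<open>Along the segment from \<open>x\<close> to \<open>y\<close>, \<open>h\<close> is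
  \<open>f\<close> minus the linear and quadratic terms of the bound. Cauchy-Schwarz and the
  Lipschitz gradient make its derivative nonpositive on [0,1], and \<open>h 1 \<le> h 0\<close> is
  the claim.\<close>

lemma smooth_with_descent:
  fixes f :: "real^'n \<Rightarrow> real"
  assumes "smooth_with L f"
  shows "f y \<le> f x + (y - x) \<bullet> grad f x + L / 2 * (norm (y - x))\<^sup>2"
proof -
  define v where "v = y - x"
  define h where "h s = f (x + s *\<^sub>R v) - s * (v \<bullet> grad f x) - L / 2 * s\<^sup>2 * (norm v)\<^sup>2" for s
  have deriv: "(h has_real_derivative
      v \<bullet> grad f (x + s *\<^sub>R v) - v \<bullet> grad f x - L * s * (norm v)\<^sup>2) (at s)" for s
  proof -
    have "f differentiable at (x + s *\<^sub>R v)"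
      using assms by (simp add: smooth_with_def)
    then have "(f has_derivative (\<lambda>k. k \<bullet> grad f (x + s *\<^sub>R v))) (at (x + s *\<^sub>R v))"
      using differentiable_GDERIV_grad gderiv_def by blast
    moreover have "((\<lambda>s. x + s *\<^sub>R v) has_derivative (\<lambda>k. k *\<^sub>R v)) (at s)"
      by (auto intro!: derivative_eq_intros)
    ultimately have "((\<lambda>s. f (x + s *\<^sub>R v)) has_derivative
        (\<lambda>k. (k *\<^sub>R v) \<bullet> grad f (x + s *\<^sub>R v))) (at s)"
      by (rule has_derivative_compose[rotated])
    then have "((\<lambda>s. f (x + s *\<^sub>R v)) has_real_derivative v \<bullet> grad f (x + s *\<^sub>R v)) (at s)"
      by (rule has_derivative_imp_has_field_derivative) simp
    then show ?thesis
      unfolding h_def by (auto intro!: derivative_eq_intros)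
  qed
  have "h 1 \<le> h 0"
  proof (rule DERIV_nonpos_imp_nonincreasing[where f = h])
    fix s :: real
    assume "0 \<le> s" "s \<le> 1"
    have "v \<bullet> grad f (x + s *\<^sub>R v) - v \<bullet> grad f x = v \<bullet> (grad f (x + s *\<^sub>R v) - grad f x)"
      by (simp add: inner_diff_right)
    also have "\<dots> \<le> norm v * norm (grad f (x + s *\<^sub>R v) - grad f x)"
      by (rule norm_cauchy_schwarz)
    also have "\<dots> \<le> norm v * (L * norm (x + s *\<^sub>R v - x))"
      using assms unfolding smooth_with_def by (blast intro: mult_left_mono norm_ge_zero)
    also have "\<dots> = L * s * (norm v)\<^sup>2"
      using \<open>0 \<le> s\<close> by (simp add: power2_eq_square)
    finally show "\<exists>d. (h has_real_derivative d) (at s) \<and> d \<le> 0"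
      using deriv by fastforce
  qed simp
  then show ?thesis
    by (simp add: h_def v_def)
qed

lemma surrogate_loss_altdef:
  "surrogate_loss L f g x \<theta> = 1/2 * (norm (g \<theta> - (x - (1/L) *\<^sub>R grad f x)))\<^sup>2"
  by (simp add: surrogate_loss_def diff_diff_eq2 diff_add_eq)

text \<open>The anchor is \<open>g \<theta>\<close> itself, so the loss at \<open>\<theta>\<close>
  is \<open>1/2 * (norm d)\<^sup>2\<close>. This cancels when the square at \<open>\<theta>'\<close>
  is expanded, and the factor \<open>L\<close> removes the \<open>1/L\<close> in
  \<open>d\<close>.\<close>

lemma surrogate_loss_diff:
  assumes "L \<noteq> 0"
  shows "L * (surrogate_loss L f g (g \<theta>) \<theta>' - surrogate_loss L f g (g \<theta>) \<theta>)
         = (g \<theta>' - g \<theta>) \<bullet> grad f (g \<theta>) + L / 2 * (norm (g \<theta>' - g \<theta>))\<^sup>2"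
proof -
  define v where "v = g \<theta>' - g \<theta>"
  define d where "d = (1/L) *\<^sub>R grad f (g \<theta>)"
  have "surrogate_loss L f g (g \<theta>) \<theta>' - surrogate_loss L f g (g \<theta>) \<theta>
      = 1/2 * (norm (v + d))\<^sup>2 - 1/2 * (norm d)\<^sup>2"
    by (simp add: surrogate_loss_def v_def d_def)
  also have "\<dots> = v \<bullet> d + 1/2 * (norm v)\<^sup>2"
    by (simp add: power2_norm_eq_inner inner_add_left inner_add_right inner_commute
        field_simps)
  finally show ?thesis
    using assms by (simp add: v_def d_def distrib_left)
qed

lemma bdd_below_surrogate_loss: "bdd_below (range (surrogate_loss L f g x))"
  by (rule bdd_belowI[of _ 0]) (auto simp: surrogate_loss_def)

lemma surrogate_inf_le: "surrogate_inf L f g x \<le> surrogate_loss L f g x \<theta>"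
  unfolding surrogate_inf_def by (rule cINF_lower[OF bdd_below_surrogate_loss UNIV_I])

text \<open>The projection lies in the closure but may not be a value of \<open>g\<close>. The bound
  still reaches it, since by continuity it defines a closed set.\<close>

lemma surrogate_inf_le_closure:
  assumes "y \<in> closure (range g)"
  shows "surrogate_inf L f g x \<le> 1/2 * (norm (y - (x - (1/L) *\<^sub>R grad f x)))\<^sup>2"
proof -
  let ?S = "{y. surrogate_inf L f g x \<le> 1/2 * (norm (y - (x - (1/L) *\<^sub>R grad f x)))\<^sup>2}"
  have "closed ?S"
    by (intro closed_Collect_le continuous_intros)
  moreover have "range g \<subseteq> ?S"
    using surrogate_inf_le[of L f g x] by (auto simp: surrogate_loss_altdef)
  ultimately show ?thesis
    using assms closure_minimal by blast
qed

text \<open>Expanding \<open>x - w\<close> around the projection leaves a cross term whose sign is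
  given by the obtuse angle criterion.\<close>

lemma closest_point_pythagoras:
  fixes S :: "'a::euclidean_space set"
  assumes "convex S" "closed S" "x \<in> S"
  shows "(norm (x - closest_point S w))\<^sup>2 + (norm (closest_point S w - w))\<^sup>2 \<le> (norm (x - w))\<^sup>2"
proof -
  let ?p = "closest_point S w"
  have "(w - ?p) \<bullet> (x - ?p) \<le> 0"
    using assms by (rule closest_point_dot)
  moreover have "(norm (x - w))\<^sup>2
      = (norm (x - ?p))\<^sup>2 + (norm (?p - w))\<^sup>2 - 2 * ((w - ?p) \<bullet> (x - ?p))"
    by (simp add: power2_norm_eq_inner inner_diff_left inner_diff_right inner_commute)
  ultimately show ?thesis
    by simp
qed

lemma surrogate_gap_ge:
  fixes f :: "real^'n \<Rightarrow> real" and g :: "real^'d \<Rightarrow> real^'n"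
  assumes "convex (closure (range g))"
  shows "1/2 * (norm (g \<theta> - closest_point (closure (range g)) (x - (1/L) *\<^sub>R grad f x)))\<^sup>2
         \<le> surrogate_loss L f g x \<theta> - surrogate_inf L f g x"
proof -
  let ?Z = "closure (range g)" and ?w = "x - (1/L) *\<^sub>R grad f x"
  have "g \<theta> \<in> ?Z"
    by (rule subsetD[OF closure_subset rangeI])
  then have "(norm (g \<theta> - closest_point ?Z ?w))\<^sup>2 + (norm (closest_point ?Z ?w - ?w))\<^sup>2
      \<le> (norm (g \<theta> - ?w))\<^sup>2"
    by (rule closest_point_pythagoras[OF assms closed_closure])
  \<comment> \<open>The projection is attained because \<open>?Z\<close> is closed and
    nonempty.\<close>
  moreover have "closest_point ?Z ?w \<in> ?Z"
    by (rule closest_point_in_set) auto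
  then have "surrogate_inf L f g x \<le> 1/2 * (norm (closest_point ?Z ?w - ?w))\<^sup>2"
    by (rule surrogate_inf_le_closure)
  ultimately show ?thesis
    by (simp add: surrogate_loss_altdef)
qed

text \<open>A decreasing sequence bounded below converges, and its shift has the same limit.\<close>

lemma decrements_tendsto_0:
  fixes u :: "nat \<Rightarrow> real"
  assumes "\<And>t. u (Suc t) \<le> u t" "bdd_below (range u)"
  shows "(\<lambda>t. u t - u (Suc t)) \<longlonglongrightarrow> 0"
proof -
  obtain l where "u \<longlonglongrightarrow> l"
    using decseq_convergent[of u] assms by (metis bdd_below.E decseq_SucI rangeI)
  then show ?thesis
    using tendsto_diff[OF _ LIMSEQ_Suc] by fastforce
qed

theorem propositionA3:
  fixes f :: "real^'n \<Rightarrow> real"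
    and g :: "real^'d \<Rightarrow> real^'n"
    and \<theta> :: "nat \<Rightarrow> real^'d"
    and z :: "nat \<Rightarrow> real^'n"
    and L \<alpha> :: real
  assumes "L > 0"
    and "smooth_with L f"
    and "convex (closure (range g))"
    and "0 \<le> \<alpha>" and "\<alpha> < 1"
    and "\<And>t. z t = g (\<theta> t)"
    and "\<And>t. surrogate_loss L f g (z t) (\<theta> (Suc t)) - surrogate_inf L f g (z t)
            \<le> \<alpha>\<^sup>2 * (surrogate_loss L f g (z t) (\<theta> t) - surrogate_inf L f g (z t))"
  shows "(\<forall>t. f (z (Suc t)) \<le> f (z t)
            - L * (1 - \<alpha>\<^sup>2) * (surrogate_loss L f g (z t) (\<theta> t) - surrogate_inf L f g (z t)))
       \<and> (bdd_below (range f) \<longrightarrow>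
            (\<lambda>t. z t - closest_point (closure (range g)) (z t - (1/L) *\<^sub>R grad f (z t)))
              \<longlonglongrightarrow> 0)"
proof -
  define gap where
    "gap t = surrogate_loss L f g (z t) (\<theta> t) - surrogate_inf L f g (z t)" for t
  define r where
    "r t = z t - closest_point (closure (range g)) (z t - (1/L) *\<^sub>R grad f (z t))" for t
  have "\<alpha>\<^sup>2 < 1"
    using assms(4,5) by (simp add: abs_square_less_1)
  then have pos: "0 < L * (1 - \<alpha>\<^sup>2)"
    using assms(1) by simp
  have descent: "f (z (Suc t)) \<le> f (z t) - L * (1 - \<alpha>\<^sup>2) * gap t" for t
  proof -
    have "f (z (Suc t))
        \<le> f (z t) + L * (surrogate_loss L f g (z t) (\<theta> (Suc t)) - surrogate_loss L f g (z t) (\<theta> t))"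
      using smooth_with_descent[OF assms(2), of "z (Suc t)" "z t"] assms(1)
      by (simp add: assms(6) surrogate_loss_diff)
    \<comment> \<open>Subtracting the infimum from both losses writes their difference as the new
      gap minus the old one, which is at most \<open>(\<alpha>\<^sup>2 - 1) * gap t\<close>.\<close>
    also have "\<dots> \<le> f (z t) + L * (- (1 - \<alpha>\<^sup>2) * gap t)"
      using assms(1) assms(7)[of t]
      by (intro add_left_mono mult_left_mono) (auto simp: gap_def algebra_simps)
    finally show ?thesis
      by (simp add: algebra_simps)
  qed
  have gap: "1/2 * (norm (r t))\<^sup>2 \<le> gap t" for t
    unfolding r_def gap_def assms(6) by (rule surrogate_gap_ge[OF assms(3)])
  have "r \<longlonglongrightarrow> 0" if bdd: "bdd_below (range f)"
  proof -
    have r_le: "L * (1 - \<alpha>\<^sup>2) / 2 * (norm (r t))\<^sup>2 \<le> f (z t) - f (z (Suc t))" for t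
      using mult_left_mono[OF gap[of t], of "L * (1 - \<alpha>\<^sup>2)"] pos descent[of t] by simp
    have "f (z (Suc t)) \<le> f (z t)" for t
      using r_le[of t] pos by (smt (verit) divide_pos_pos mult_nonneg_nonneg zero_le_power2)
    moreover have "bdd_below (range (\<lambda>t. f (z t)))"
      using bdd by (rule bdd_below_mono) auto
    ultimately have "(\<lambda>t. f (z t) - f (z (Suc t))) \<longlonglongrightarrow> 0"
      by (rule decrements_tendsto_0)
    \<comment> \<open>Squeezed between 0 and the decrements of \<open>f\<close> by
      \<open>r_le\<close>; the positive constant is divided out next.\<close>
    then have "(\<lambda>t. L * (1 - \<alpha>\<^sup>2) / 2 * (norm (r t))\<^sup>2) \<longlonglongrightarrow> 0"
      by (rule tendsto_sandwich[OF _ _ tendsto_const, rotated 2])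
        (use r_le pos in auto)
    then have "(\<lambda>t. (norm (r t))\<^sup>2) \<longlonglongrightarrow> 0"
      using pos tendsto_mult_left_iff[of "L * (1 - \<alpha>\<^sup>2) / 2" "\<lambda>t. (norm (r t))\<^sup>2" 0]
      by (simp only: mult_zero_right)
    then show ?thesis
      by (simp add: tendsto_norm_zero_iff)
  qed
  then show ?thesis
    using descent unfolding gap_def r_def by blast
qed

end
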